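(* Let $(\alpha_1,\dots,\alpha_n)$ be any $n$-tuple of real numbers such that $\alpha_1$ is irrational but not a Liouville number. Then there exist constants $C>0$ and $T_0$ (independent of $T_1,\dots,T_n$ and $\gamma$) such that for any positive integers $T_1,\dots,T_n$ with $T_1>T_0$ and for any $\gamma\in\mathbb{R}$, $$\sum_{\substack{\mathbf q=(q_1,\dots,q_n)\in\mathbb{Z}^n\\ 1\le q_j\le T_j\ (1\le j\le n)}}\frac{1}{\|q_1\alpha_1+\dots+q_n\alpha_n-\gamma\|}\ \ge\ C\,T_1\cdots T_n\log T_1.$$
   Context: $\|x\|$ denotes the distance from $x\in\mathbb{R}$ to the nearest integer. A Liouville number is an $\alpha\in\mathbb{R}\setminus\mathbb{Q}$ such that $\liminf_{m\to\infty}m^w\|m\alpha\|=0$ for all $w>0$. A term with vanishing denominator is interpreted as $+\infty$. *)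

theory Defs
  imports "HOL-Library.Extended_Real" "HOL-Library.FuncSet"
begin

definition dist_int :: "real \<Rightarrow> real" where
  "dist_int x = \<bar>x - of_int (round x)\<bar>"

lemma dist_int_le: "dist_int x \<le> \<bar>x - of_int k\<bar>"
  unfolding dist_int_def by (rule round_diff_minimal)

text \<open>The sequence is embedded into the extended reals so that its lower limit exists
  even when it is unbounded; all its terms are nonnegative.\<close>

definition liouville_number :: "real \<Rightarrow> bool" where
  "liouville_number \<alpha> \<longleftrightarrow>
     \<alpha> \<notin> \<rat> \<and>
     (\<forall>w::real. w > 0 \<longrightarrow>
        liminf (\<lambda>m::nat. ereal (real m powr w * dist_int (real m * \<alpha>))) = 0)"

text \<open>Reciprocal of a nonnegative real with the convention that the reciprocal of zero
  is \<open>+\<infinity>\<close>: this is how division behaves on the extended reals.\<close>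

definition ext_recip :: "real \<Rightarrow> ereal" where
  "ext_recip x = 1 / ereal x"

lemma ext_recip_0: "ext_recip 0 = \<infinity>"
  by (simp add: ext_recip_def)

lemma ext_recip_pos: "x > 0 \<Longrightarrow> ext_recip x = ereal (1 / x)"
  by (simp add: ext_recip_def one_ereal_def)

end

theory Submission
  imports Defs "HOL-Analysis.Kronecker_Approximation_Theorem" "HOL-Analysis.Harmonic_Numbers"
begin

text \<open>
  Freezing \<open>q\<^sub>2, \<dots>, q\<^sub>n\<close> only changes the shift \<open>\<gamma>\<close>, so everything follows from a
  one-dimensional bound that is uniform in \<open>\<gamma>\<close>: the sum of
  \<open>1 / \<parallel>m\<alpha> - \<gamma>\<parallel>\<close> over \<open>1 \<le> m \<le> T\<close> is at least a constant times \<open>T log T\<close>.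

  Let \<open>h / k\<close> be a reduced fraction with \<open>k \<le> T\<close> and \<open>\<bar>k\<alpha> - h\<bar> < 1 / T\<close>, as supplied by
  Dirichlet's theorem.  Over any \<open>k\<close> consecutive integers \<open>m\<close>, the points \<open>m\<alpha> - \<gamma>\<close> deviate by at
  most \<open>1 / k\<close> from a translate of the points \<open>mh / k\<close>, and these run through all multiples of
  \<open>1 / k\<close> modulo \<open>1\<close>.  Hence for each \<open>r = 0, \<dots>, k - 1\<close> the block contains its own point at
  distance at most \<open>(r + 2) / k\<close> from an integer, and the block contributes at
  least \<open>k (1/2 + \<dots> + 1/(k+1))\<close>, which is of order \<open>k log k\<close>
  (\<open>sum_ext_recip_block\<close>).  Packing \<open>T div k \<ge> T / (2 k)\<close> disjoint blocks into \<open>{1..T}\<close>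
  yields a bound of order \<open>T log k\<close> (\<open>sum_ext_recip_interval\<close>).

  The Diophantine hypothesis enters only to convert \<open>log k\<close> into \<open>log T\<close>: a number that is neither
  rational nor Liouville satisfies \<open>\<parallel>k\<alpha>\<parallel> \<ge> c k\<^bsup>-w\<^esup>\<close> for some positive constants \<open>c\<close> and \<open>w\<close>
  (\<open>non_liouville_lower_bound\<close>), so
  \<open>\<parallel>k\<alpha>\<parallel> < 1 / T\<close> forces \<open>k\<close> to exceed a constant multiple of \<open>T\<^bsup>1/w\<^esup>\<close>.
\<close>

section \<open>The Diophantine condition\<close>

lemma dist_int_nonneg: "dist_int x \<ge> 0"
  by (simp add: dist_int_def)

lemma dist_int_irrational_multiple_pos:
  assumes "\<alpha> \<notin> \<rat>" "m > 0"
  shows "dist_int (real m * \<alpha>) > 0"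
proof (rule ccontr)
  assume "\<not> ?thesis"
  then have "real m * \<alpha> = of_int (round (real m * \<alpha>))"
    by (simp add: dist_int_def)
  then have "\<alpha> = of_int (round (real m * \<alpha>)) / real m"
    using \<open>m > 0\<close> by (simp add: field_simps)
  then have "\<alpha> \<in> \<rat>"
    by (metis Rats_divide Rats_of_int Rats_of_nat)
  with assms show False by simp
qed

text \<open>A nonzero lower limit bounds all but finitely many terms away from zero, and irrationality
  makes each of the remaining ones positive.\<close>

lemma non_liouville_lower_bound:
  assumes "\<alpha> \<notin> \<rat>" "\<not> liouville_number \<alpha>"
  obtains c w where "c > 0" "w > 0"
    "\<And>m::nat. m > 0 \<Longrightarrow> c \<le> real m powr w * dist_int (real m * \<alpha>)"
proof -
  obtain w :: real where w: "w > 0"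
    "liminf (\<lambda>m::nat. ereal (real m powr w * dist_int (real m * \<alpha>))) \<noteq> 0"
    using assms by (auto simp: liouville_number_def)
  define f where "f = (\<lambda>m::nat. real m powr w * dist_int (real m * \<alpha>))"
  have "0 \<le> liminf (\<lambda>m. ereal (f m))"
    by (intro Liminf_bounded always_eventually) (auto simp: f_def dist_int_nonneg)
  then have "0 < liminf (\<lambda>m. ereal (f m))"
    using w(2) by (simp add: f_def order_less_le)
  then obtain b where b: "0 < ereal b" "ereal b < liminf (\<lambda>m. ereal (f m))"
    using ereal_dense2 by blast
  obtain M where M: "\<And>m. m \<ge> M \<Longrightarrow> b < f m"
    using less_LiminfD[OF b(2)] by (auto simp: eventually_sequentially)
  have f_pos: "f m > 0" if "m > 0" for m
    using that assms(1) by (simp add: f_def dist_int_irrational_multiple_pos)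
  define c where "c = Min (insert b (f ` {0<..<M}))"
  have "c > 0"
    using b(1) f_pos by (auto simp: c_def)
  moreover have "c \<le> f m" if "m > 0" for m
  proof (cases "m < M")
    case True
    with that show ?thesis by (simp add: c_def)
  next
    case False
    have "c \<le> b" by (simp add: c_def)
    with M[of m] False show ?thesis by simp
  qed
  ultimately show thesis
    using that[of c w] w(1) by (simp add: f_def)
qed

section \<open>Sums of reciprocal distances along an interval\<close>

lemma ext_recip_lower:
  assumes "dist_int x \<le> y" "y > 0"
  shows "ereal (1 / y) \<le> ext_recip (dist_int x)"
proof (cases "dist_int x = 0")
  case True
  then show ?thesis by (simp add: ext_recip_0)
next
  case False
  with dist_int_nonneg[of x] have "dist_int x > 0" by simp
  with assms show ?thesis by (simp add: ext_recip_pos frac_le)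
qed

lemma ext_recip_dist_int_nonneg: "0 \<le> ext_recip (dist_int x)"
  using dist_int_nonneg[of x]
  by (cases "dist_int x = 0") (simp_all add: ext_recip_0 ext_recip_pos)

text \<open>Multiplication by a unit permutes the residues modulo \<open>k\<close>, also after a translation.\<close>

lemma bij_betw_affine_mod:
  fixes h k s :: int
  assumes "coprime h k" "k > 0"
  shows "bij_betw (\<lambda>m. (m * h + s) mod k) {1..k} {0..<k}"
proof -
  have inj: "inj_on (\<lambda>m. (m * h + s) mod k) {1..k}"
  proof (rule inj_onI)
    fix m m' assume m: "m \<in> {1..k}" "m' \<in> {1..k}"
      and eq: "(m * h + s) mod k = (m' * h + s) mod k"
    then have "k dvd (m * h + s) - (m' * h + s)"
      by (simp only: mod_eq_dvd_iff)
    then have "k dvd (m - m') * h"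
      by (simp add: left_diff_distrib)
    then have dvd: "k dvd m - m'"
      using coprime_dvd_mult_left_iff[of k h "m - m'"] assms(1) coprime_commute[of h k] by blast
    have "\<bar>m - m'\<bar> < k"
      using m by auto
    with dvd have "m - m' = 0"
      using dvd_imp_le_int[of "m - m'" k] by linarith
    then show "m = m'" by simp
  qed
  have sub: "(\<lambda>m. (m * h + s) mod k) ` {1..k} \<subseteq> {0..<k}"
    using assms(2) by auto
  have "card ((\<lambda>m. (m * h + s) mod k) ` {1..k}) = card {0..<k}"
    using card_image[OF inj] by simp
  with sub have "(\<lambda>m. (m * h + s) mod k) ` {1..k} = {0..<k}"
    by (intro card_subset_eq) auto
  with inj show ?thesis by (simp add: bij_betw_def)
qed

lemma sum_shifted_harmonic_ge:
  fixes k :: int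
  assumes "k > 0"
  shows "(\<Sum>r\<in>{0..<k}. real_of_int k / (real_of_int r + 2)) \<ge> real_of_int k * ln (real_of_int k) / 2"
proof -
  define K where "K = nat k"
  have k: "k = int K" and K: "K > 0" using assms by (auto simp: K_def)
  have img: "{0..<k} = int ` {..<K}"
    unfolding k by (simp add: image_int_atLeastLessThan lessThan_atLeast0)
  have "ln (real K) \<le> harm K"
    using ln_le_harm[of K] K by (smt (verit) ln_less_cancel_iff of_nat_0_less_iff)
  then have "real K * ln (real K) / 2 \<le> (real K / 2) * harm K"
    by (simp add: mult_left_mono)
  also have "\<dots> = (\<Sum>r<K. (real K / 2) * inverse (real (Suc r)))"
    by (simp add: harm_altdef sum_distrib_left)
  \<comment> \<open>halving each term absorbs the shift, because \<open>r + 2 \<le> 2 (r + 1)\<close>\<close>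
  also have "\<dots> \<le> (\<Sum>r<K. real K / (real r + 2))"
    by (intro sum_mono) (auto simp: field_simps)
  also have "\<dots> = (\<Sum>r\<in>{0..<k}. real_of_int k / (real_of_int r + 2))"
    unfolding img by (subst sum.reindex) (auto simp: k)
  finally show ?thesis by (simp add: k)
qed

text \<open>Up to an error of \<open>2 / k\<close> the points of a block are the multiples \<open>r / k\<close> modulo \<open>1\<close>: the
  rational approximation of \<open>\<alpha>\<close> and the rounding of the translation to a multiple
  of \<open>1 / k\<close> each cost at most \<open>1 / k\<close>.\<close>

lemma sum_ext_recip_block:
  fixes h k a :: int and \<alpha> \<gamma> :: real
  assumes "coprime h k" "k > 0" and approx: "\<bar>of_int k * \<alpha> - of_int h\<bar> \<le> 1 / of_int k"
  shows "ereal (of_int k * ln (of_int k) / 2)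
    \<le> (\<Sum>m\<in>{a + 1..a + k}. ext_recip (dist_int (of_int m * \<alpha> - \<gamma>)))"
proof -
  define \<theta> where "\<theta> = of_int a * \<alpha> - \<gamma>"
  define s where "s = \<lfloor>of_int k * \<theta>\<rfloor>"
  define r where "r = (\<lambda>m. (m * h + s) mod k)"
  have kp: "real_of_int k > 0" using assms(2) by simp
  have bij: "bij_betw r {1..k} {0..<k}"
    unfolding r_def by (rule bij_betw_affine_mod[OF assms(1,2)])
  have point: "ereal (of_int k / (of_int (r m) + 2))
      \<le> ext_recip (dist_int (of_int (a + m) * \<alpha> - \<gamma>))" if m: "m \<in> {1..k}" for m
  proof -
    define d where "d = (m * h + s) div k"
    have "m * h + s = k * d + r m"
      by (simp add: d_def r_def)
    then have dr: "of_int m * of_int h + of_int s = of_int k * of_int d + real_of_int (r m)"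
      by (metis of_int_add of_int_mult)
    have r0: "real_of_int (r m) \<ge> 0" using assms(2) by (simp add: r_def)
    have s: "0 \<le> of_int k * \<theta> - of_int s" "of_int k * \<theta> - of_int s \<le> 1"
      unfolding s_def by linarith+
    have "\<bar>of_int m * (of_int k * \<alpha> - of_int h)\<bar> \<le> of_int k * (1 / of_int k)"
      unfolding abs_mult using m assms(2) by (intro mult_mono approx) auto
    then have e: "\<bar>of_int m * (of_int k * \<alpha> - of_int h)\<bar> \<le> 1"
      using kp by simp
    have "of_int k * (of_int (a + m) * \<alpha> - \<gamma> - of_int d)
        = of_int m * (of_int k * \<alpha> - of_int h) + (of_int k * \<theta> - of_int s) + of_int (r m)"
      using dr by (simp add: \<theta>_def algebra_simps)
    then have "\<bar>of_int k * (of_int (a + m) * \<alpha> - \<gamma> - of_int d)\<bar> \<le> of_int (r m) + 2"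
      using e s r0 by linarith
    then have "\<bar>of_int (a + m) * \<alpha> - \<gamma> - of_int d\<bar> \<le> (of_int (r m) + 2) / of_int k"
      using kp by (simp add: abs_mult pos_le_divide_eq mult.commute)
    then have "dist_int (of_int (a + m) * \<alpha> - \<gamma>) \<le> (of_int (r m) + 2) / of_int k"
      using dist_int_le order_trans by blast
    from ext_recip_lower[OF this] show ?thesis
      using r0 kp by simp
  qed
  have "ereal (of_int k * ln (of_int k) / 2)
      \<le> ereal (\<Sum>j\<in>{0..<k}. real_of_int k / (real_of_int j + 2))"
    using sum_shifted_harmonic_ge[OF assms(2)] by simp
  also have "\<dots> = ereal (\<Sum>m\<in>{1..k}. real_of_int k / (real_of_int (r m) + 2))"
    using sum.reindex_bij_betw[OF bij, of "\<lambda>j. real_of_int k / (real_of_int j + 2)"] by simp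
  also have "\<dots> = (\<Sum>m\<in>{1..k}. ereal (real_of_int k / (real_of_int (r m) + 2)))"
    by simp
  also have "\<dots> \<le> (\<Sum>m\<in>{1..k}. ext_recip (dist_int (of_int (a + m) * \<alpha> - \<gamma>)))"
    by (intro sum_mono point)
  also have "\<dots> = (\<Sum>m\<in>{a + 1..a + k}. ext_recip (dist_int (of_int m * \<alpha> - \<gamma>)))"
    by (rule sum.reindex_bij_witness[where j = "\<lambda>m. a + m" and i = "\<lambda>m. m - a"]) auto
  finally show ?thesis .
qed

lemma sum_ext_recip_blocks:
  fixes h k :: int and \<alpha> \<gamma> :: real and j :: nat
  assumes "coprime h k" "k > 0" "\<bar>of_int k * \<alpha> - of_int h\<bar> \<le> 1 / of_int k"
  shows "ereal (real j * (of_int k * ln (of_int k) / 2))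
    \<le> (\<Sum>m\<in>{1..int j * k}. ext_recip (dist_int (of_int m * \<alpha> - \<gamma>)))"
proof (induction j)
  case 0
  then show ?case by simp
next
  case (Suc j)
  define F where "F = (\<lambda>m::int. ext_recip (dist_int (of_int m * \<alpha> - \<gamma>)))"
  have split: "{1..int (Suc j) * k} = {1..int j * k} \<union> {int j * k + 1..int j * k + k}"
  proof -
    have "int j * k \<ge> 0" and Suc_k: "int (Suc j) * k = int j * k + k"
      using assms(2) by (simp_all add: algebra_simps)
    moreover have "{1..N + k} = {1..N} \<union> {N + 1..N + k}" if "N \<ge> 0" for N
      using that assms(2) by auto
    ultimately show ?thesis by (simp only: Suc_k)
  qed
  have "ereal (real (Suc j) * (of_int k * ln (of_int k) / 2))
      = ereal (real j * (of_int k * ln (of_int k) / 2)) + ereal (of_int k * ln (of_int k) / 2)"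
    by (simp add: algebra_simps add_divide_distrib)
  also have "\<dots> \<le> sum F {1..int j * k} + sum F {int j * k + 1..int j * k + k}"
    unfolding F_def by (intro add_mono Suc.IH sum_ext_recip_block[OF assms])
  also have "\<dots> = sum F {1..int (Suc j) * k}"
    unfolding split by (rule sum.union_disjoint[symmetric]) auto
  finally show ?case by (simp only: F_def)
qed

lemma sum_ext_recip_interval:
  fixes h k :: int and \<alpha> \<gamma> :: real and T :: nat
  assumes "coprime h k" "k > 0" "k \<le> int T" "\<bar>of_int k * \<alpha> - of_int h\<bar> \<le> 1 / of_int k"
  shows "ereal (real T * ln (of_int k) / 4)
    \<le> (\<Sum>m\<in>{1..int T}. ext_recip (dist_int (of_int m * \<alpha> - \<gamma>)))"
proof -
  define j where "j = nat (int T div k)"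
  have j: "int j = int T div k"
    using assms(2) by (simp add: j_def pos_imp_zdiv_nonneg_iff)
  have jk: "int j * k \<le> int T"
    using assms(2) unfolding j
    using div_mult_mod_eq[of "int T" k] pos_mod_sign[of k "int T"] by linarith
  have "int j \<ge> 1"
    using assms(2,3) unfolding j by (simp add: pos_imp_zdiv_pos_iff int_one_le_iff_zero_less)
  then have "k \<le> int j * k"
    using assms(2) by simp
  moreover have "int T < int j * k + k"
    using assms(2) unfolding j
    using div_mult_mod_eq[of "int T" k] pos_mod_bound[of k "int T"] by linarith
  ultimately have "int T \<le> 2 * (int j * k)"
    by linarith
  then have "real_of_int (int T) \<le> real_of_int (2 * (int j * k))"
    by (simp only: of_int_le_iff)
  then have T: "real T \<le> 2 * (real j * of_int k)"
    by simp
  have "ln (real_of_int k) \<ge> 0"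
    using assms(2) by simp
  then have "real T * ln (of_int k) / 4 \<le> real j * (of_int k * ln (of_int k) / 2)"
    using mult_right_mono[OF T, of "ln (of_int k)"] by simp
  then have "ereal (real T * ln (of_int k) / 4) \<le> ereal (real j * (of_int k * ln (of_int k) / 2))"
    by simp
  also have "\<dots> \<le> (\<Sum>m\<in>{1..int j * k}. ext_recip (dist_int (of_int m * \<alpha> - \<gamma>)))"
    by (rule sum_ext_recip_blocks[OF assms(1,2,4)])
  also have "\<dots> \<le> (\<Sum>m\<in>{1..int T}. ext_recip (dist_int (of_int m * \<alpha> - \<gamma>)))"
    using jk by (intro sum_mono2) (auto simp: ext_recip_dist_int_nonneg)
  finally show ?thesis .
qed

text \<open>Dirichlet's theorem with bound \<open>T\<close> supplies the denominator \<open>k\<close>. Since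
  \<open>c k\<^bsup>-w\<^esup> \<le> \<parallel>k\<alpha>\<parallel> < 1 / T\<close>, it satisfies \<open>k\<^bsup>w\<^esup> > c T\<close>, and \<open>c T \<ge> \<surd>T\<close> as soon
  as \<open>T \<ge> c\<^bsup>-2\<^esup>\<close>.\<close>

lemma one_dimensional_lower_bound:
  assumes "\<alpha> \<notin> \<rat>" "\<not> liouville_number \<alpha>"
  obtains C T\<^sub>0 :: real where "C > 0"
    "\<And>(T::nat) \<gamma>. real T > T\<^sub>0 \<Longrightarrow> ereal (C * real T * ln (real T))
       \<le> (\<Sum>m\<in>{1..int T}. ext_recip (dist_int (of_int m * \<alpha> - \<gamma>)))"
proof -
  obtain c w where c: "c > 0" and w: "w > 0"
    and cw: "\<And>m::nat. m > 0 \<Longrightarrow> c \<le> real m powr w * dist_int (real m * \<alpha>)"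
    using non_liouville_lower_bound[OF assms] by blast
  have bound: "ereal (1 / (8 * w) * real T * ln (real T))
       \<le> (\<Sum>m\<in>{1..int T}. ext_recip (dist_int (of_int m * \<alpha> - \<gamma>)))"
    if T: "real T > c powr (-2)" for T \<gamma>
  proof -
    have Tp: "real T > 0" using T by (smt (verit) powr_ge_zero)
    then obtain h k where hk: "coprime h k" "0 < k" "k \<le> int T"
        "\<bar>of_int k * \<alpha> - of_int h\<bar> < 1 / T"
      using Dirichlet_approx_coprime[of T \<alpha>] by auto
    have kp: "real_of_int k > 0" using hk by simp
    have "1 / real T \<le> 1 / of_int k"
      using hk(2,3) by (intro divide_left_mono) auto
    then have approx: "\<bar>of_int k * \<alpha> - of_int h\<bar> \<le> 1 / of_int k"
      using hk(4) by linarith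
    have "c \<le> of_int k powr w * dist_int (of_int k * \<alpha>)"
      using cw[of "nat k"] hk(2) by simp
    also have "\<dots> \<le> of_int k powr w * (1 / T)"
      using hk(4) dist_int_le[of "of_int k * \<alpha>" h] by (intro mult_left_mono) auto
    finally have "c * T \<le> of_int k powr w"
      using Tp by (simp add: field_simps)
    then have "ln (c * T) \<le> ln (of_int k powr w)"
      using c Tp kp by (subst ln_le_cancel_iff) simp_all
    then have "ln c + ln T \<le> w * ln (of_int k)"
      using c Tp kp by (simp add: ln_mult ln_powr)
    moreover have "-2 * ln c < ln T"
      using T Tp c by (metis ln_less_cancel_iff ln_powr powr_gt_zero less_irrefl)
    ultimately have "ln T \<le> 2 * w * ln (of_int k)"
      by linarith
    then have "ln T / (2 * w) \<le> ln (of_int k)"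
      using w by (simp add: field_simps)
    then have "(real T / 4) * (ln T / (2 * w)) \<le> (real T / 4) * ln (of_int k)"
      by (intro mult_left_mono) auto
    then have "ereal (1 / (8 * w) * real T * ln (real T)) \<le> ereal (real T * ln (of_int k) / 4)"
      by (simp add: field_simps)
    also have "\<dots> \<le> (\<Sum>m\<in>{1..int T}. ext_recip (dist_int (of_int m * \<alpha> - \<gamma>)))"
      by (rule sum_ext_recip_interval[OF hk(1-3) approx])
    finally show ?thesis .
  qed
  show thesis
    using that[of "1 / (8 * w)" "c powr (-2)"] bound w by simp
qed

section \<open>Reduction to one dimension\<close>

lemma sum_PiE_insert:
  fixes f :: "('a \<Rightarrow> 'b) \<Rightarrow> 'c::comm_monoid_add"
  assumes "i \<notin> I"
  shows "sum f (Pi\<^sub>E (insert i I) A) = (\<Sum>g\<in>Pi\<^sub>E I A. \<Sum>x\<in>A i. f (g(i := x)))"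
proof -
  have "sum f (Pi\<^sub>E (insert i I) A) = (\<Sum>(x, g)\<in>A i \<times> Pi\<^sub>E I A. f (g(i := x)))"
    unfolding PiE_insert_eq
    by (subst sum.reindex[OF inj_combinator[OF assms]]) (simp add: case_prod_unfold comp_def)
  also have "\<dots> = (\<Sum>x\<in>A i. \<Sum>g\<in>Pi\<^sub>E I A. f (g(i := x)))"
    by (rule sum.cartesian_product[symmetric])
  also have "\<dots> = (\<Sum>g\<in>Pi\<^sub>E I A. \<Sum>x\<in>A i. f (g(i := x)))"
    by (rule sum.swap)
  finally show ?thesis .
qed

theorem theorem1p9:
  fixes n :: nat and \<alpha> :: "nat \<Rightarrow> real"
  assumes "n \<ge> 1"
    and "\<alpha> 1 \<notin> \<rat>"
    and "\<not> liouville_number (\<alpha> 1)"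
  shows "\<exists>(C::real) (T\<^sub>0::real). C > 0 \<and>
    (\<forall>(T :: nat \<Rightarrow> nat) (\<gamma>::real).
       (\<forall>j\<in>{1..n}. T j \<ge> 1) \<and> real (T 1) > T\<^sub>0 \<longrightarrow>
       (\<Sum>q\<in>(\<Pi>\<^sub>E j\<in>{1..n}. {1..int (T j)}).
          ext_recip (dist_int ((\<Sum>j=1..n. real_of_int (q j) * \<alpha> j) - \<gamma>)))
       \<ge> ereal (C * (\<Prod>j=1..n. real (T j)) * ln (real (T 1))))"
proof -
  obtain C T\<^sub>0 :: real where C: "C > 0"
    and bound: "\<And>(T::nat) \<gamma>. real T > T\<^sub>0 \<Longrightarrow> ereal (C * real T * ln (real T))
       \<le> (\<Sum>m\<in>{1..int T}. ext_recip (dist_int (of_int m * \<alpha> 1 - \<gamma>)))"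
    using one_dimensional_lower_bound[OF assms(2,3)] by metis
  have ins: "{1..n} = insert 1 {2..n}" using assms(1) by auto
  have main: "ereal (C * (\<Prod>j=1..n. real (T j)) * ln (real (T 1)))
      \<le> (\<Sum>q\<in>(\<Pi>\<^sub>E j\<in>{1..n}. {1..int (T j)}).
          ext_recip (dist_int ((\<Sum>j=1..n. real_of_int (q j) * \<alpha> j) - \<gamma>)))"
    if T: "real (T 1) > T\<^sub>0" for T :: "nat \<Rightarrow> nat" and \<gamma>
  proof -
    define B where "B = (\<Pi>\<^sub>E j\<in>{2..n}. {1..int (T j)})"
    have shift: "(\<Sum>j=1..n. real_of_int ((g(1 := x)) j) * \<alpha> j) - \<gamma>
        = of_int x * \<alpha> 1 - (\<gamma> - (\<Sum>j=2..n. real_of_int (g j) * \<alpha> j))" for g and x :: int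
      unfolding ins by simp
    have "C * (\<Prod>j=1..n. real (T j)) * ln (real (T 1))
        = (\<Sum>g\<in>B. C * real (T 1) * ln (real (T 1)))"
      unfolding ins B_def by (simp add: card_PiE)
    then have "ereal (C * (\<Prod>j=1..n. real (T j)) * ln (real (T 1)))
        = (\<Sum>g\<in>B. ereal (C * real (T 1) * ln (real (T 1))))"
      by (simp only: sum_ereal)
    also have "\<dots> \<le> (\<Sum>g\<in>B. \<Sum>x\<in>{1..int (T 1)}. ext_recip (dist_int
        (of_int x * \<alpha> 1 - (\<gamma> - (\<Sum>j=2..n. real_of_int (g j) * \<alpha> j)))))"
      by (intro sum_mono bound T)
    also have "\<dots> = (\<Sum>g\<in>B. \<Sum>x\<in>{1..int (T 1)}. ext_recip (dist_int
        ((\<Sum>j=1..n. real_of_int ((g(1 := x)) j) * \<alpha> j) - \<gamma>)))"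
      by (simp only: shift)
    also have "\<dots> = (\<Sum>q\<in>(\<Pi>\<^sub>E j\<in>{1..n}. {1..int (T j)}).
          ext_recip (dist_int ((\<Sum>j=1..n. real_of_int (q j) * \<alpha> j) - \<gamma>)))"
      unfolding B_def
      by (subst (3) ins, subst sum_PiE_insert) auto
    finally show ?thesis .
  qed
  show ?thesis
    using C main by blast
qed

end
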